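(* Let $z(x,y)$ be a (positive) solution of the equation $$z_{yy}+\left(\frac1z\right)_{xx}+2=0,$$ and let $w=\frac12\ln z$. Determine a function $\phi'$ by $$\cos\phi'=\frac{w_x^2-e^{2w}-e^{4w}w_y^2}{\sqrt{(w_x+e^{2w}w_y)^2+e^{2w}}\,\sqrt{(w_x-e^{2w}w_y)^2+e^{2w}}},$$ $$\sin\phi'=-\frac{2e^{w}w_x}{\sqrt{(w_x+e^{2w}w_y)^2+e^{2w}}\,\sqrt{(w_x-e^{2w}w_y)^2+e^{2w}}},$$ and new coordinates $\xi,\eta$ by $$d\xi=\tfrac12\sqrt{(w_x+e^{2w}w_y)^2+e^{2w}}\,dx+\tfrac12\sqrt{(e^{-2w}w_x+w_y)^2+e^{-2w}}\,dy,$$ $$d\eta=\tfrac12\sqrt{(w_x-e^{2w}w_y)^2+e^{2w}}\,dx-\tfrac12\sqrt{(e^{-2w}w_x-w_y)^2+e^{-2w}}\,dy.$$ Then $\phi'(\xi,\eta)$, i.e. $\phi'$ expressed as a function of $\xi,\eta$, is a solution of the sine-Gordon equation $$\phi_{\xi\eta}=\sin\phi.$$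
   Context: The equation $z_{yy}+(1/z)_{xx}+2=0$ is called the constant astigmatism equation. All considerations are local and functions are smooth and real-valued; subscripts denote partial derivatives; $\phi'$ (the prime is part of the name, not a derivative) is a smooth local choice of the angle determined modulo $2\pi$ by its cosine and sine; $\xi,\eta$ are determined up to additive constants. *)

theory Defs
  imports "HOL-Analysis.Analysis"
begin

text \<open>All notions of differentiability below are meant for \<^emph>\<open>open\<close> sets \<open>S\<close>: derivatives are
  taken at the points of \<open>S\<close> in the ambient space, and only depend on the function near them.\<close>

primrec Ck_on :: "nat \<Rightarrow> 'a::real_normed_vector set \<Rightarrow> ('a \<Rightarrow> 'b::real_normed_vector) \<Rightarrow> bool" where
  "Ck_on 0 S f \<longleftrightarrow> continuous_on S f"
| "Ck_on (Suc n) S f \<longleftrightarrow>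
     (\<forall>p\<in>S. f differentiable (at p)) \<and>
     (\<forall>v. Ck_on n S (\<lambda>p. frechet_derivative f (at p) v))"

definition smooth_on :: "'a::real_normed_vector set \<Rightarrow> ('a \<Rightarrow> 'b::real_normed_vector) \<Rightarrow> bool" where
  "smooth_on S f \<longleftrightarrow> (\<forall>n. Ck_on n S f)"

definition pd1 :: "(real \<times> real \<Rightarrow> real) \<Rightarrow> real \<times> real \<Rightarrow> real" where
  "pd1 f = (\<lambda>(s, t). deriv (\<lambda>u. f (u, t)) s)"

definition pd2 :: "(real \<times> real \<Rightarrow> real) \<Rightarrow> real \<times> real \<Rightarrow> real" where
  "pd2 f = (\<lambda>(s, t). deriv (\<lambda>u. f (s, u)) t)"

definition constant_astigmatism_solution :: "(real \<times> real) set \<Rightarrow> (real \<times> real \<Rightarrow> real) \<Rightarrow> bool" where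
  "constant_astigmatism_solution U z \<longleftrightarrow> open U \<and> smooth_on U z \<and>
     (\<forall>p\<in>U. pd2 (pd2 z) p + pd1 (pd1 (\<lambda>q. 1 / z q)) p + 2 = 0)"

definition sine_gordon_solution :: "(real \<times> real) set \<Rightarrow> (real \<times> real \<Rightarrow> real) \<Rightarrow> bool" where
  "sine_gordon_solution S f \<longleftrightarrow> open S \<and> smooth_on S f \<and>
     (\<forall>q\<in>S. pd2 (pd1 f) q = sin (f q))"

definition half_ln :: "(real \<times> real \<Rightarrow> real) \<Rightarrow> real \<times> real \<Rightarrow> real" where
  "half_ln z p = 1 / 2 * ln (z p)"

definition is_angle :: "(real \<times> real) set \<Rightarrow> (real \<times> real \<Rightarrow> real) \<Rightarrow> (real \<times> real \<Rightarrow> real) \<Rightarrow> bool" where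
  "is_angle V w \<phi> \<longleftrightarrow> smooth_on V \<phi> \<and>
     (\<forall>p\<in>V.
        cos (\<phi> p) =
          ((pd1 w p)\<^sup>2 - exp (2 * w p) - exp (4 * w p) * (pd2 w p)\<^sup>2) /
          (sqrt ((pd1 w p + exp (2 * w p) * pd2 w p)\<^sup>2 + exp (2 * w p)) *
           sqrt ((pd1 w p - exp (2 * w p) * pd2 w p)\<^sup>2 + exp (2 * w p))) \<and>
        sin (\<phi> p) =
          - (2 * exp (w p) * pd1 w p /
             (sqrt ((pd1 w p + exp (2 * w p) * pd2 w p)\<^sup>2 + exp (2 * w p)) *
              sqrt ((pd1 w p - exp (2 * w p) * pd2 w p)\<^sup>2 + exp (2 * w p)))))"

text \<open>A one-form \<open>a dx + b dy\<close> at a point is the linear functional \<open>(dx, dy) \<mapsto> a dx + b dy\<close>.\<close>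

definition is_xi :: "(real \<times> real) set \<Rightarrow> (real \<times> real \<Rightarrow> real) \<Rightarrow> (real \<times> real \<Rightarrow> real) \<Rightarrow> bool" where
  "is_xi V w \<xi> \<longleftrightarrow> smooth_on V \<xi> \<and>
     (\<forall>p\<in>V. (\<xi> has_derivative (\<lambda>(dx, dy).
        1 / 2 * sqrt ((pd1 w p + exp (2 * w p) * pd2 w p)\<^sup>2 + exp (2 * w p)) * dx +
        1 / 2 * sqrt ((exp (- 2 * w p) * pd1 w p + pd2 w p)\<^sup>2 + exp (- 2 * w p)) * dy)) (at p))"

definition is_eta :: "(real \<times> real) set \<Rightarrow> (real \<times> real \<Rightarrow> real) \<Rightarrow> (real \<times> real \<Rightarrow> real) \<Rightarrow> bool" where
  "is_eta V w \<eta> \<longleftrightarrow> smooth_on V \<eta> \<and>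
     (\<forall>p\<in>V. (\<eta> has_derivative (\<lambda>(dx, dy).
        1 / 2 * sqrt ((pd1 w p - exp (2 * w p) * pd2 w p)\<^sup>2 + exp (2 * w p)) * dx -
        1 / 2 * sqrt ((exp (- 2 * w p) * pd1 w p - pd2 w p)\<^sup>2 + exp (- 2 * w p)) * dy)) (at p))"

definition coord_map :: "(real \<times> real \<Rightarrow> real) \<Rightarrow> (real \<times> real \<Rightarrow> real) \<Rightarrow> real \<times> real \<Rightarrow> real \<times> real" where
  "coord_map \<xi> \<eta> p = (\<xi> p, \<eta> p)"

definition coordinates_on :: "(real \<times> real) set \<Rightarrow> (real \<times> real \<Rightarrow> real) \<Rightarrow> (real \<times> real \<Rightarrow> real) \<Rightarrow> bool" where
  "coordinates_on W \<xi> \<eta> \<longleftrightarrow>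
     open W \<and> smooth_on W (coord_map \<xi> \<eta>) \<and> inj_on (coord_map \<xi> \<eta>) W \<and>
     open (coord_map \<xi> \<eta> ` W) \<and>
     smooth_on (coord_map \<xi> \<eta> ` W) (inv_into W (coord_map \<xi> \<eta>))"

text \<open>The function \<open>f\<close> on \<open>W\<close> expressed in the coordinates \<open>\<xi>, \<eta>\<close>; it is meaningful
  on the image of \<open>W\<close> under the coordinate map.\<close>

definition in_coordinates ::
  "(real \<times> real) set \<Rightarrow> (real \<times> real \<Rightarrow> real) \<Rightarrow> (real \<times> real \<Rightarrow> real) \<Rightarrow> (real \<times> real \<Rightarrow> real) \<Rightarrow>
   real \<times> real \<Rightarrow> real" where
  "in_coordinates W \<xi> \<eta> f = f \<circ> inv_into W (coord_map \<xi> \<eta>)"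

end

theory Submission
  imports Defs
begin

text \<open>Put \<open>D\<^sub>\<plusminus> = \<partial>\<^sub>x \<plusminus> e\<^sup>2\<^sup>w \<partial>\<^sub>y\<close>, \<open>P\<^sub>\<plusminus> = D\<^sub>\<plusminus> w\<close> and
  \<open>R\<^sub>\<plusminus> = sqrt (P\<^sub>\<plusminus>\<^sup>2 + e\<^sup>2\<^sup>w)\<close>. The constant astigmatism equation says exactly that
  \<open>D\<^sub>\<minusplus> P\<^sub>\<plusminus> = 2 w\<^sub>x P\<^sub>\<plusminus> + e\<^sup>2\<^sup>w\<close>. Consequently \<open>D\<^sub>\<minusplus> R\<^sub>\<plusminus> = 2 w\<^sub>x R\<^sub>\<plusminus>\<close>, which makes the
  forms \<open>d\<xi>\<close> and \<open>d\<eta>\<close> closed, and the angles \<open>\<theta>\<^sub>\<plusminus> = arctan (e\<^sup>-\<^sup>w P\<^sub>\<plusminus>)\<close> satisfy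
  \<open>D\<^sub>\<minusplus> \<theta>\<^sub>\<plusminus> = e\<^sup>w\<close>. One choice of \<open>\<phi>'\<close> is \<open>\<theta>\<^sub>+ + \<theta>\<^sub>- - \<pi>\<close>, and any other has the same derivative.
  In the new coordinates \<open>\<partial>\<^sub>\<xi> = D\<^sub>+ / R\<^sub>+\<close> and \<open>\<partial>\<^sub>\<eta> = D\<^sub>- / R\<^sub>-\<close>, so that the commutator
  \<open>[D\<^sub>-, D\<^sub>+] = 2 w\<^sub>x (D\<^sub>+ - D\<^sub>-)\<close> turns these identities into the sine-Gordon equation.\<close>

subsection \<open>Smooth functions\<close>

lemma Ck_on_cong:
  assumes "open S" "Ck_on n S f" "\<And>p. p \<in> S \<Longrightarrow> f p = g p"
  shows "Ck_on n S g"
  using assms(2,3)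
proof (induction n arbitrary: f g)
  case 0
  then show ?case using continuous_on_cong by (metis Ck_on.simps(1))
next
  case (Suc n)
  have *: "(g has_derivative frechet_derivative f (at p)) (at p)" if "p \<in> S" for p
    using Suc.prems that assms(1)
    by (metis Ck_on.simps(2) frechet_derivative_works has_derivative_transform_within_open)
  have "Ck_on n S (\<lambda>p. frechet_derivative g (at p) v)" for v
    by (rule Suc.IH[of "\<lambda>p. frechet_derivative f (at p) v"])
      (use Suc.prems(1) frechet_derivative_at[OF *] in auto)
  then show ?case using * by (auto simp: differentiable_def)
qed

text \<open>Derivatives are unique, so any explicitly given derivative can stand in for
  \<open>frechet_derivative\<close>. The closure properties below are inductions on the order
  through this rule.\<close>

lemma Ck_on_SucI:
  assumes "open S" "\<And>p. p \<in> S \<Longrightarrow> (f has_derivative f' p) (at p)" "\<And>v. Ck_on n S (\<lambda>p. f' p v)"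
  shows "Ck_on (Suc n) S f"
proof -
  have "Ck_on n S (\<lambda>p. frechet_derivative f (at p) v)" for v
    by (rule Ck_on_cong[OF assms(1) assms(3)[of v]]) (use assms(2) frechet_derivative_at in metis)
  then show ?thesis using assms(2) by (auto simp: differentiable_def)
qed

lemma Ck_on_SucD: "Ck_on (Suc n) S f \<Longrightarrow> Ck_on n S f"
proof (induction n arbitrary: f)
  case 0
  then show ?case
    by (auto intro!: continuous_at_imp_continuous_on dest: differentiable_imp_continuous_within)
qed auto

lemma Ck_on_has_derivative:
  "Ck_on (Suc n) S f \<Longrightarrow> p \<in> S \<Longrightarrow> (f has_derivative frechet_derivative f (at p)) (at p)"
  by (simp add: frechet_derivative_works)

lemma Ck_on_subset: "Ck_on n S f \<Longrightarrow> T \<subseteq> S \<Longrightarrow> Ck_on n T f"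
  by (induction n arbitrary: f) (auto intro: continuous_on_subset)

lemma Ck_on_const: "Ck_on n S (\<lambda>p. c)"
  by (induction n arbitrary: c) auto

lemma Ck_on_compose_linear:
  assumes "open S" "bounded_linear L" "Ck_on n S f"
  shows "Ck_on n S (\<lambda>p. L (f p))"
  using assms(3)
proof (induction n arbitrary: f)
  case 0
  then show ?case using assms(2) by (simp add: linear_continuous_on_compose bounded_linear.continuous_on)
next
  case (Suc n)
  show ?case
    by (rule Ck_on_SucI[OF assms(1) bounded_linear.has_derivative[OF assms(2) Ck_on_has_derivative[OF Suc.prems]]])
      (use Suc in auto)
qed

lemma Ck_on_add:
  assumes "open S" "Ck_on n S f" "Ck_on n S g"
  shows "Ck_on n S (\<lambda>p. f p + g p)"
  using assms(2,3)
proof (induction n arbitrary: f g)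
  case 0
  then show ?case by (auto intro: continuous_intros)
next
  case (Suc n)
  show ?case
    by (rule Ck_on_SucI[OF assms(1)
          has_derivative_add[OF Ck_on_has_derivative[OF Suc.prems(1)] Ck_on_has_derivative[OF Suc.prems(2)]]])
      (use Suc in auto)
qed

lemma Ck_on_sum:
  assumes "open S" "finite I" "\<And>i. i \<in> I \<Longrightarrow> Ck_on n S (f i)"
  shows "Ck_on n S (\<lambda>p. \<Sum>i\<in>I. f i p)"
  using assms(2,3) by (induction rule: finite_induct) (auto intro: Ck_on_const Ck_on_add[OF assms(1)])

lemma Ck_on_Pair:
  assumes "open S" "Ck_on n S f" "Ck_on n S g"
  shows "Ck_on n S (\<lambda>p. (f p, g p))"
  using assms(2,3)
proof (induction n arbitrary: f g)
  case 0
  then show ?case by (auto intro: continuous_intros)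
next
  case (Suc n)
  show ?case
    by (rule Ck_on_SucI[OF assms(1)
          has_derivative_Pair[OF Ck_on_has_derivative[OF Suc.prems(1)] Ck_on_has_derivative[OF Suc.prems(2)]]])
      (use Suc in auto)
qed

lemma Ck_on_bilinear:
  assumes "open S" "bounded_bilinear b" "Ck_on n S f" "Ck_on n S g"
  shows "Ck_on n S (\<lambda>p. b (f p) (g p))"
  using assms(3,4)
proof (induction n arbitrary: f g)
  case 0
  then show ?case using bounded_bilinear.continuous_on[OF assms(2)] by auto
next
  case (Suc n)
  have "Ck_on n S f" "Ck_on n S g" "\<And>v. Ck_on n S (\<lambda>p. frechet_derivative f (at p) v)"
    "\<And>v. Ck_on n S (\<lambda>p. frechet_derivative g (at p) v)"
    using Suc.prems by (auto intro: Ck_on_SucD simp del: Ck_on.simps) (auto)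
  then show ?case
    by (intro Ck_on_SucI[OF assms(1)
          bounded_bilinear.FDERIV[OF assms(2) Ck_on_has_derivative[OF Suc.prems(1)] Ck_on_has_derivative[OF Suc.prems(2)]]]
        Ck_on_add[OF assms(1)] Suc.IH)
qed

text \<open>In the chain rule the direction \<open>?df p v\<close> moves with \<open>p\<close>,
  whereas \<open>Ck_on\<close> controls derivatives in fixed directions only. Expanding it in the
  basis of the Euclidean middle space leaves a finite sum of products, to which the induction
  hypothesis for derivatives of \<open>g\<close> applies.\<close>

lemma Ck_on_compose:
  fixes f :: "'a::real_normed_vector \<Rightarrow> 'b::euclidean_space"
  assumes "open S" "open T" "Ck_on n S f" "Ck_on n T g" "f ` S \<subseteq> T"
  shows "Ck_on n S (\<lambda>p. g (f p))"
  using assms(3,4)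
proof (induction n arbitrary: g)
  case 0
  then show ?case using assms(5) by (auto intro: continuous_on_compose2)
next
  case (Suc n)
  have inT: "f p \<in> T" if "p \<in> S" for p using assms(5) that by auto
  let ?df = "\<lambda>p. frechet_derivative f (at p)" and ?dg = "\<lambda>q. frechet_derivative g (at q)"
  have expand: "?dg (f p) (?df p v) = (\<Sum>i\<in>Basis. (?df p v \<bullet> i) *\<^sub>R ?dg (f p) i)" if "p \<in> S" for p v
  proof -
    have "linear (?dg (f p))"
      using Ck_on_has_derivative[OF Suc.prems(2) inT[OF that]] has_derivative_linear by blast
    then have "?dg (f p) (\<Sum>i\<in>Basis. (?df p v \<bullet> i) *\<^sub>R i) = (\<Sum>i\<in>Basis. (?df p v \<bullet> i) *\<^sub>R ?dg (f p) i)"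
      by (simp add: linear_sum linear_scale)
    then show ?thesis by (simp add: euclidean_representation)
  qed
  show ?case
  proof (rule Ck_on_SucI[OF assms(1)])
    show "((\<lambda>p. g (f p)) has_derivative (\<lambda>v. ?dg (f p) (?df p v))) (at p)" if "p \<in> S" for p
      by (rule has_derivative_compose[OF Ck_on_has_derivative[OF Suc.prems(1) that]
            Ck_on_has_derivative[OF Suc.prems(2) inT[OF that]]])
    fix v
    have "Ck_on n S (\<lambda>p. \<Sum>i\<in>Basis. (?df p v \<bullet> i) *\<^sub>R ?dg (f p) i)"
    proof (intro Ck_on_sum[OF assms(1)] Ck_on_bilinear[OF assms(1) bounded_bilinear_scaleR]
        Ck_on_compose_linear[OF assms(1) bounded_linear_inner_left] Suc.IH)
      show "Ck_on n S f" using Suc.prems(1) by (rule Ck_on_SucD)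
    qed (use Suc.prems in simp_all)
    then show "Ck_on n S (\<lambda>p. ?dg (f p) (?df p v))"
      by (rule Ck_on_cong[OF assms(1)]) (simp add: expand)
  qed
qed

lemma Ck_on_exp: "Ck_on n UNIV (exp :: real \<Rightarrow> real)"
proof (induction n)
  case (Suc n)
  show ?case
    by (rule Ck_on_SucI[where f' = "\<lambda>x v. v * exp x"])
      (auto intro!: derivative_eq_intros Ck_on_bilinear[OF _ bounded_bilinear_mult] Ck_on_const Suc)
qed (auto intro: continuous_intros)

text \<open>The derivative is a polynomial in \<open>inverse\<close> itself, so the product rule and
  the induction hypothesis close the step.\<close>

lemma Ck_on_inverse: "Ck_on n {0<..} (inverse :: real \<Rightarrow> real)"
proof (induction n)
  case (Suc n)
  show ?case
  proof (rule Ck_on_SucI[where f' = "\<lambda>x v. (- v) * (inverse x * inverse x)"])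
    show "Ck_on n {0<..} (\<lambda>x::real. (- v) * (inverse x * inverse x))" for v
      by (intro Ck_on_bilinear[OF _ bounded_bilinear_mult] Ck_on_const Suc) auto
  qed (auto intro!: derivative_eq_intros)
qed (auto intro!: continuous_intros)

lemma Ck_on_ln: "Ck_on n {0<..} (ln :: real \<Rightarrow> real)"
proof (cases n)
  case (Suc n)
  show ?thesis unfolding Suc
  proof (rule Ck_on_SucI[where f' = "\<lambda>x v. v * inverse x"])
    show "Ck_on n {0<..} (\<lambda>x::real. v * inverse x)" for v
      by (intro Ck_on_bilinear[OF _ bounded_bilinear_mult] Ck_on_const Ck_on_inverse) auto
  qed (auto intro!: derivative_eq_intros simp: field_simps)
qed (auto intro!: continuous_intros)

section \<open>Smooth functions: closure properties and elementary compositions\<close>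

lemma smooth_on_cong:
  "open S \<Longrightarrow> smooth_on S f \<Longrightarrow> (\<And>p. p \<in> S \<Longrightarrow> f p = g p) \<Longrightarrow> smooth_on S g"
  unfolding smooth_on_def using Ck_on_cong by blast

lemma smooth_on_subset: "smooth_on S f \<Longrightarrow> T \<subseteq> S \<Longrightarrow> smooth_on T f"
  unfolding smooth_on_def using Ck_on_subset by blast

lemma smooth_on_has_derivative:
  "smooth_on S f \<Longrightarrow> p \<in> S \<Longrightarrow> (f has_derivative frechet_derivative f (at p)) (at p)"
  unfolding smooth_on_def using Ck_on_has_derivative by blast

lemma smooth_on_frechet_derivative: "smooth_on S f \<Longrightarrow> smooth_on S (\<lambda>p. frechet_derivative f (at p) v)"
  unfolding smooth_on_def by (metis Ck_on.simps(2))

lemma smooth_on_imp_continuous_on: "smooth_on S f \<Longrightarrow> continuous_on S f"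
  unfolding smooth_on_def by (metis Ck_on.simps(1))

text \<open>A smooth derivative is C^n for each n, which makes the function C^(n+1) at once.\<close>

lemma smooth_onI:
  assumes "open S" "\<And>p. p \<in> S \<Longrightarrow> (f has_derivative f' p) (at p)" "\<And>v. smooth_on S (\<lambda>p. f' p v)"
  shows "smooth_on S f"
  unfolding smooth_on_def
proof
  fix n
  have "Ck_on (Suc n) S f"
    using assms by (intro Ck_on_SucI[where f' = f']) (auto simp: smooth_on_def)
  then show "Ck_on n S f" by (rule Ck_on_SucD)
qed

lemma smooth_on_const: "smooth_on S (\<lambda>p. c)"
  by (simp add: smooth_on_def Ck_on_const)

lemma smooth_on_compose:
  fixes f :: "'a::real_normed_vector \<Rightarrow> 'b::euclidean_space"
  assumes "open S" "open T" "smooth_on S f" "smooth_on T g" "f ` S \<subseteq> T"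
  shows "smooth_on S (\<lambda>p. g (f p))"
  using assms unfolding smooth_on_def by (blast intro: Ck_on_compose)

lemma smooth_on_Pair: "open S \<Longrightarrow> smooth_on S f \<Longrightarrow> smooth_on S g \<Longrightarrow> smooth_on S (\<lambda>p. (f p, g p))"
  by (simp add: smooth_on_def Ck_on_Pair)

lemma smooth_on_add: "open S \<Longrightarrow> smooth_on S f \<Longrightarrow> smooth_on S g \<Longrightarrow> smooth_on S (\<lambda>p. f p + g p)"
  by (simp add: smooth_on_def Ck_on_add)

lemma smooth_on_mult:
  fixes f g :: "'a::real_normed_vector \<Rightarrow> real"
  shows "open S \<Longrightarrow> smooth_on S f \<Longrightarrow> smooth_on S g \<Longrightarrow> smooth_on S (\<lambda>p. f p * g p)"
  by (simp add: smooth_on_def Ck_on_bilinear[OF _ bounded_bilinear_mult])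

lemma smooth_on_minus: "open S \<Longrightarrow> smooth_on S f \<Longrightarrow> smooth_on S (\<lambda>p. - f p)"
  unfolding smooth_on_def
  using Ck_on_compose_linear[OF _ bounded_linear_minus[OF bounded_linear_ident]] by blast

lemma smooth_on_diff: "open S \<Longrightarrow> smooth_on S f \<Longrightarrow> smooth_on S g \<Longrightarrow> smooth_on S (\<lambda>p. f p - g p)"
  using smooth_on_add[OF _ _ smooth_on_minus, of S f g] by simp

lemma smooth_on_power:
  fixes f :: "'a::real_normed_vector \<Rightarrow> real"
  shows "open S \<Longrightarrow> smooth_on S f \<Longrightarrow> smooth_on S (\<lambda>p. f p ^ n)"
  by (induction n) (simp_all add: smooth_on_const smooth_on_mult)

lemma smooth_on_exp:
  fixes f :: "'a::real_normed_vector \<Rightarrow> real"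
  shows "open S \<Longrightarrow> smooth_on S f \<Longrightarrow> smooth_on S (\<lambda>p. exp (f p))"
  using smooth_on_compose[of S UNIV f exp] by (simp add: smooth_on_def Ck_on_exp)

lemma smooth_on_inverse:
  fixes f :: "'a::real_normed_vector \<Rightarrow> real"
  shows "open S \<Longrightarrow> smooth_on S f \<Longrightarrow> (\<And>p. p \<in> S \<Longrightarrow> f p > 0) \<Longrightarrow> smooth_on S (\<lambda>p. inverse (f p))"
  using smooth_on_compose[of S "{0<..}" f inverse] by (auto simp: smooth_on_def Ck_on_inverse)

lemma smooth_on_divide:
  fixes f g :: "'a::real_normed_vector \<Rightarrow> real"
  shows "open S \<Longrightarrow> smooth_on S f \<Longrightarrow> smooth_on S g \<Longrightarrow> (\<And>p. p \<in> S \<Longrightarrow> g p > 0) \<Longrightarrow>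
    smooth_on S (\<lambda>p. f p / g p)"
  by (simp add: divide_inverse smooth_on_mult smooth_on_inverse)

lemma smooth_on_ln:
  fixes f :: "'a::real_normed_vector \<Rightarrow> real"
  shows "open S \<Longrightarrow> smooth_on S f \<Longrightarrow> (\<And>p. p \<in> S \<Longrightarrow> f p > 0) \<Longrightarrow> smooth_on S (\<lambda>p. ln (f p))"
  using smooth_on_compose[of S "{0<..}" f ln] by (auto simp: smooth_on_def Ck_on_ln)

text \<open>On positive values the root is exp (ln f / 2), which reduces the claim to
  \<open>exp\<close> and \<open>ln\<close>.\<close>

lemma smooth_on_sqrt:
  fixes f :: "'a::real_normed_vector \<Rightarrow> real"
  assumes "open S" "smooth_on S f" "\<And>p. p \<in> S \<Longrightarrow> f p > 0"
  shows "smooth_on S (\<lambda>p. sqrt (f p))"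
proof (rule smooth_on_cong[OF assms(1)])
  show "smooth_on S (\<lambda>p. exp (ln (f p) * (1 / 2)))"
    using assms by (intro smooth_on_exp smooth_on_mult smooth_on_ln smooth_on_const)
  show "exp (ln (f p) * (1 / 2)) = sqrt (f p)" if "p \<in> S" for p
    using assms(3)[OF that] by (simp add: ln_sqrt[symmetric])
qed

lemma smooth_on_arctan:
  fixes f :: "'a::real_normed_vector \<Rightarrow> real"
  assumes "open S" "smooth_on S f"
  shows "smooth_on S (\<lambda>p. arctan (f p))"
proof (rule smooth_onI[OF assms(1)])
  let ?d = "\<lambda>p v. frechet_derivative f (at p) v * inverse (1 + (f p)\<^sup>2)"
  show "((\<lambda>p. arctan (f p)) has_derivative ?d p) (at p)" if "p \<in> S" for p
    using smooth_on_has_derivative[OF assms(2) that]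
    by (auto intro!: derivative_eq_intros simp: field_simps)
  show "smooth_on S (\<lambda>p. ?d p v)" for v
    using assms
    by (intro smooth_on_mult smooth_on_frechet_derivative smooth_on_inverse smooth_on_add
        smooth_on_power smooth_on_const) (auto intro: add_pos_nonneg)
qed

text \<open>Bootstrapping: if \<open>g\<close> is C\<open>^n\<close>, then so is the right-hand side \<open>J \<circ> g\<close> of its differential
  equation, hence \<open>g\<close> is C\<open>^(n+1)\<close>.\<close>

lemma smooth_on_autonomous:
  fixes g :: "'a::real_normed_vector \<Rightarrow> 'b::euclidean_space"
  assumes "open T" "open V" "\<And>y. y \<in> T \<Longrightarrow> (g has_derivative J (g y)) (at y)" "g ` T \<subseteq> V"
    and J: "\<And>k. smooth_on V (\<lambda>p. J p k)"
  shows "smooth_on T g"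
  unfolding smooth_on_def
proof
  fix n show "Ck_on n T g"
  proof (induction n)
    case 0
    show ?case
      using assms(3) by (auto intro!: continuous_at_imp_continuous_on dest: has_derivative_continuous)
  next
    case (Suc n)
    show ?case
    proof (rule Ck_on_SucI[OF assms(1,3)])
      show "Ck_on n T (\<lambda>y. J (g y) k)" for k
        using J by (intro Ck_on_compose[OF assms(1,2) Suc _ assms(4)]) (simp add: smooth_on_def)
    qed
  qed
qed

lemmas smooth_intros = smooth_on_const smooth_on_add smooth_on_diff smooth_on_minus smooth_on_mult
  smooth_on_divide smooth_on_power smooth_on_exp smooth_on_ln smooth_on_sqrt smooth_on_arctan

subsection \<open>Partial derivatives and closed forms in the plane\<close>

lemma pd_eq_derivative:
  assumes "(f has_derivative f') (at p)"
  shows "pd1 f p = f' (1, 0)" "pd2 f p = f' (0, 1)"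
proof -
  obtain s t where p: "p = (s, t)" by fastforce
  have lin: "linear f'" using assms has_derivative_linear by blast
  have "((\<lambda>u. (u, t)) has_derivative (\<lambda>h. (h, 0))) (at s)"
    and "((\<lambda>u. (s, u)) has_derivative (\<lambda>h. (0, h))) (at t)"
    by (auto intro!: derivative_eq_intros)
  then have "((\<lambda>u. f (u, t)) has_derivative (\<lambda>h. f' (h, 0))) (at s)"
    and "((\<lambda>u. f (s, u)) has_derivative (\<lambda>h. f' (0, h))) (at t)"
    using assms p by (auto intro: has_derivative_compose)
  moreover have "f' (h, 0) = f' (1, 0) * h" "f' (0, h) = f' (0, 1) * h" for h :: real
    using linear_scale[OF lin, of h "(1, 0)"] linear_scale[OF lin, of h "(0, 1)"] by simp_all
  then have "(\<lambda>h. f' (h, 0)) = (*) (f' (1, 0))" "(\<lambda>h. f' (0, h)) = (*) (f' (0, 1))"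
    unfolding fun_eq_iff by blast+
  ultimately have "((\<lambda>u. f (u, t)) has_real_derivative f' (1, 0)) (at s)"
    and "((\<lambda>u. f (s, u)) has_real_derivative f' (0, 1)) (at t)"
    unfolding has_field_derivative_def by (simp_all only:)
  then show "pd1 f p = f' (1, 0)" "pd2 f p = f' (0, 1)"
    by (simp_all add: p pd1_def pd2_def DERIV_imp_deriv)
qed

lemma has_derivative_pd:
  assumes "(f has_derivative f') (at p)"
  shows "(f has_derivative (\<lambda>h. pd1 f p * fst h + pd2 f p * snd h)) (at p)"
proof -
  have lin: "linear f'" using assms has_derivative_linear by blast
  have "(\<lambda>h. f' (1, 0) * fst h + f' (0, 1) * snd h) = f'"
  proof
    fix h
    have "f' h = f' (fst h *\<^sub>R (1, 0) + snd h *\<^sub>R (0, 1))" by simp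
    also have "\<dots> = fst h *\<^sub>R f' (1, 0) + snd h *\<^sub>R f' (0, 1)"
      by (simp only: linear_add[OF lin] linear_scale[OF lin])
    finally show "f' (1, 0) * fst h + f' (0, 1) * snd h = f' h" by (simp add: mult.commute)
  qed
  with assms show ?thesis unfolding pd_eq_derivative[OF assms] by (simp only:)
qed

lemma pd_cong:
  assumes "open S" "p \<in> S" "\<And>q. q \<in> S \<Longrightarrow> f q = g q" "f differentiable (at p)"
  shows "pd1 g p = pd1 f p" "pd2 g p = pd2 f p"
  using assms has_derivative_transform_within_open[OF _ assms(1,2)] pd_eq_derivative
  unfolding differentiable_def by metis+

lemma smooth_on_has_derivative_pd:
  "smooth_on S f \<Longrightarrow> p \<in> S \<Longrightarrow> (f has_derivative (\<lambda>h. pd1 f p * fst h + pd2 f p * snd h)) (at p)"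
  by (rule has_derivative_pd[OF smooth_on_has_derivative])

lemma smooth_on_pd:
  assumes "open S" "smooth_on S f"
  shows "smooth_on S (pd1 f)" "smooth_on S (pd2 f)"
  using smooth_on_cong[OF assms(1) smooth_on_frechet_derivative[OF assms(2), of "(1, 0)"], of "pd1 f"]
    smooth_on_cong[OF assms(1) smooth_on_frechet_derivative[OF assms(2), of "(0, 1)"], of "pd2 f"]
    pd_eq_derivative[OF smooth_on_has_derivative[OF assms(2)]] by simp_all

lemma pd_add:
  assumes "f differentiable (at p)" "g differentiable (at p)"
  shows "pd1 (\<lambda>q. f q + g q) p = pd1 f p + pd1 g p" "pd2 (\<lambda>q. f q + g q) p = pd2 f p + pd2 g p"
proof -
  obtain f' g' where d: "(f has_derivative f') (at p)" "(g has_derivative g') (at p)"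
    using assms by (auto simp: differentiable_def)
  show "pd1 (\<lambda>q. f q + g q) p = pd1 f p + pd1 g p" "pd2 (\<lambda>q. f q + g q) p = pd2 f p + pd2 g p"
    by (simp_all add: pd_eq_derivative[OF d(1)] pd_eq_derivative[OF d(2)]
        pd_eq_derivative[OF has_derivative_add[OF d]])
qed

lemma pd_mult:
  assumes "f differentiable (at p)" "g differentiable (at p)"
  shows "pd1 (\<lambda>q. f q * g q) p = f p * pd1 g p + pd1 f p * g p"
    and "pd2 (\<lambda>q. f q * g q) p = f p * pd2 g p + pd2 f p * g p"
proof -
  obtain f' g' where d: "(f has_derivative f') (at p)" "(g has_derivative g') (at p)"
    using assms by (auto simp: differentiable_def)
  show "pd1 (\<lambda>q. f q * g q) p = f p * pd1 g p + pd1 f p * g p"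
    and "pd2 (\<lambda>q. f q * g q) p = f p * pd2 g p + pd2 f p * g p"
    by (simp_all add: pd_eq_derivative[OF d(1)] pd_eq_derivative[OF d(2)]
        pd_eq_derivative[OF has_derivative_mult[OF d]])
qed

lemma pd_chain:
  assumes "f differentiable (at p)" "(h has_real_derivative h') (at (f p))"
  shows "pd1 (\<lambda>q. h (f q)) p = h' * pd1 f p" "pd2 (\<lambda>q. h (f q)) p = h' * pd2 f p"
proof -
  obtain f' where d: "(f has_derivative f') (at p)"
    using assms by (auto simp: differentiable_def)
  note c = has_derivative_compose[OF d assms(2)[unfolded has_field_derivative_def]]
  show "pd1 (\<lambda>q. h (f q)) p = h' * pd1 f p" "pd2 (\<lambda>q. h (f q)) p = h' * pd2 f p"
    by (simp_all add: pd_eq_derivative[OF d] pd_eq_derivative[OF c])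
qed

lemma pd_const [simp]: "pd1 (\<lambda>q. c) p = 0" "pd2 (\<lambda>q. c) p = 0"
  by (simp_all add: pd_eq_derivative[OF has_derivative_const])

lemma smooth_on_imp_differentiable: "smooth_on S f \<Longrightarrow> p \<in> S \<Longrightarrow> f differentiable (at p)"
  using smooth_on_has_derivative by (auto simp: differentiable_def)

text \<open>Serves to rewrite the equation for z in terms of w: with c = 2 the exponential is z,
  with c = -2 it is 1/z.\<close>

lemma pd_pd_exp:
  assumes "open U" "smooth_on U w" "p \<in> U"
  shows "pd1 (pd1 (\<lambda>q. exp (c * w q))) p = c * exp (c * w p) * (pd1 (pd1 w) p + c * (pd1 w p)\<^sup>2)"
    and "pd2 (pd2 (\<lambda>q. exp (c * w q))) p = c * exp (c * w p) * (pd2 (pd2 w) p + c * (pd2 w p)\<^sup>2)"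
proof -
  note diff = smooth_on_imp_differentiable
  have exp_deriv: "((\<lambda>x. exp (c * x)) has_real_derivative c * exp (c * x)) (at x)" for x
    by (auto intro!: derivative_eq_intros)
  note first = pd_chain[OF diff[OF assms(2)] exp_deriv]
  have smooth: "smooth_on U (\<lambda>q. c * exp (c * w q))" "smooth_on U (pd1 w)" "smooth_on U (pd2 w)"
    using assms by (auto intro!: smooth_intros smooth_on_pd)
  have d: "(\<lambda>q. c * exp (c * w q)) differentiable (at p)" "(\<lambda>q. exp (c * w q)) differentiable (at p)"
    "pd1 w differentiable (at p)" "pd2 w differentiable (at p)"
    using smooth assms by (auto intro!: smooth_intros diff[OF _ assms(3)])
  have "pd1 (pd1 (\<lambda>q. exp (c * w q))) p = pd1 (\<lambda>q. (c * exp (c * w q)) * pd1 w q) p"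
    using assms smooth by (intro pd_cong[of U] diff[of U] smooth_intros) (auto simp: first)
  then show "pd1 (pd1 (\<lambda>q. exp (c * w q))) p = c * exp (c * w p) * (pd1 (pd1 w) p + c * (pd1 w p)\<^sup>2)"
    using d by (simp add: pd_mult first[OF assms(3)] power2_eq_square algebra_simps)
  have "pd2 (pd2 (\<lambda>q. exp (c * w q))) p = pd2 (\<lambda>q. (c * exp (c * w q)) * pd2 w q) p"
    using assms smooth by (intro pd_cong[of U] diff[of U] smooth_intros) (auto simp: first)
  then show "pd2 (pd2 (\<lambda>q. exp (c * w q))) p = c * exp (c * w p) * (pd2 (pd2 w) p + c * (pd2 w p)\<^sup>2)"
    using d by (simp add: pd_mult first[OF assms(3)] power2_eq_square algebra_simps)
qed

section \<open>Integration on rectangles: symmetry of second derivatives and potentials\<close>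

lemma smooth_on_has_partial_derivatives:
  assumes "smooth_on S f" "(x, y) \<in> S"
  shows "((\<lambda>u. f (u, y)) has_real_derivative pd1 f (x, y)) (at x)"
    and "((\<lambda>u. f (x, u)) has_real_derivative pd2 f (x, y)) (at y)"
proof -
  note f = smooth_on_has_derivative_pd[OF assms]
  have "((\<lambda>u. (u, y)) has_derivative (\<lambda>h. (h, 0))) (at x)"
    and "((\<lambda>u. (x, u)) has_derivative (\<lambda>h. (0, h))) (at y)"
    by (auto intro!: derivative_eq_intros)
  from has_derivative_compose[OF this(1) f] has_derivative_compose[OF this(2) f]
  show "((\<lambda>u. f (u, y)) has_real_derivative pd1 f (x, y)) (at x)"
    and "((\<lambda>u. f (x, u)) has_real_derivative pd2 f (x, y)) (at y)"
    by (simp_all add: has_field_derivative_def)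
qed

lemma has_real_derivative_integral_upper_bound:
  fixes h :: "real \<Rightarrow> real"
  assumes "continuous_on {a..b} h" "x \<in> {a<..<b}"
  shows "((\<lambda>x. integral {a..x} h) has_real_derivative h x) (at x)"
proof -
  have "x \<in> interior {a..b}" using assms(2) by simp
  then have "at x within {a..b} = at x" by (rule at_within_interior)
  then show ?thesis using integral_has_real_derivative[OF assms(1), of x] assms(2) by simp
qed

lemma has_real_derivative_integral_parameter:
  assumes "open U" "smooth_on U h" "{c..c'} \<times> {d..d'} \<subseteq> U" "x \<in> {c<..<c'}" "y \<le> d'"
  shows "((\<lambda>x. integral {d..y} (\<lambda>t. h (x, t))) has_real_derivative
          integral {d..y} (\<lambda>t. pd1 h (x, t))) (at x)"
proof -
  have inU: "(u, t) \<in> U" if "u \<in> {c<..<c'}" "t \<in> {d..y}" for u t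
    using assms that by auto
  have cont: "continuous_on {d..y} (\<lambda>t. h (u, t))" if "u \<in> {c<..<c'}" for u
    using inU[OF that]
    by (intro continuous_on_compose2[OF smooth_on_imp_continuous_on[OF assms(2)]] continuous_intros) auto
  have cont1: "continuous_on ({c<..<c'} \<times> {d..y}) (\<lambda>(u, t). pd1 h (u, t))"
    unfolding case_prod_eta
    by (rule continuous_on_subset[OF smooth_on_imp_continuous_on[OF smooth_on_pd(1)[OF assms(1,2)]]])
      (use inU in auto)
  have "((\<lambda>x. integral (cbox d y) (\<lambda>t. h (x, t))) has_real_derivative
      integral (cbox d y) (\<lambda>t. pd1 h (x, t))) (at x within {c<..<c'})"
  proof (rule leibniz_rule_field_derivative)
    show "((\<lambda>u. h (u, t)) has_real_derivative pd1 h (u, t)) (at u within {c<..<c'})"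
      if "u \<in> {c<..<c'}" "t \<in> cbox d y" for u t
      using that inU
      by (intro has_field_derivative_at_within[OF smooth_on_has_partial_derivatives(1)[OF assms(2)]]) simp
    show "(\<lambda>t. h (u, t)) integrable_on cbox d y" if "u \<in> {c<..<c'}" for u
      using cont[OF that] by (intro integrable_continuous) simp
    show "continuous_on ({c<..<c'} \<times> cbox d y) (\<lambda>(u, t). pd1 h (u, t))"
      using cont1 by (simp only: cbox_interval)
  qed (use assms(4) in simp_all)
  moreover have "at x within {c<..<c'} = at x"
    by (rule at_within_open[OF assms(4)]) simp
  ultimately show ?thesis by (simp only: cbox_interval)
qed

lemma open_contains_rectangle:
  fixes p :: "real \<times> real"
  assumes "open U" "p \<in> U"
  obtains c c' d d' where "{c..c'} \<times> {d..d'} \<subseteq> U" "p \<in> {c<..<c'} \<times> {d<..<d'}"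
proof (rule open_contains_cbox[OF assms])
  fix a b
  assume "cbox a b \<subseteq> U" "p \<in> box a b"
  then show thesis
    by (intro that[of "fst a" "fst b" "snd a" "snd b"]) (simp_all add: cbox_prod box_prod)
qed

text \<open>On a rectangle, f(u,v) is f(u,d) plus the integral of its second partial derivative from
  d to v. Differentiating in u under the integral sign, then in v by the fundamental theorem,
  produces the mixed derivative in the other order.\<close>

lemma pd_commute:
  assumes "open U" "smooth_on U f" "p \<in> U"
  shows "pd2 (pd1 f) p = pd1 (pd2 f) p"
proof -
  obtain c c' d d' where R: "{c..c'} \<times> {d..d'} \<subseteq> U" "p \<in> {c<..<c'} \<times> {d<..<d'}"
    using open_contains_rectangle[OF assms(1,3)] .
  obtain x y where p: "p = (x, y)" by fastforce
  have x: "x \<in> {c<..<c'}" and y: "y \<in> {d<..<d'}" using R p by auto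
  have inU: "(u, t) \<in> U" if "u \<in> {c<..<c'}" "t \<in> {d..d'}" for u t
    using R that by auto
  note f2 = smooth_on_pd(2)[OF assms(1,2)]
  have int: "f (u, v) = f (u, d) + integral {d..v} (\<lambda>t. pd2 f (u, t))"
    if "u \<in> {c<..<c'}" "v \<in> {d<..<d'}" for u v
  proof -
    have "((\<lambda>t. pd2 f (u, t)) has_integral f (u, v) - f (u, d)) {d..v}"
      using that inU[OF that(1)]
      by (intro fundamental_theorem_of_calculus)
        (auto simp flip: has_real_derivative_iff_has_vector_derivative
          intro!: has_field_derivative_at_within[OF smooth_on_has_partial_derivatives(2)[OF assms(2)]])
    then show ?thesis by (simp add: integral_unique)
  qed
  have pd1_int: "pd1 f (x, v) = pd1 f (x, d) + integral {d..v} (\<lambda>t. pd1 (pd2 f) (x, t))"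
    if v: "v \<in> {d<..<d'}" for v
  proof (rule DERIV_unique)
    show "((\<lambda>u. f (u, v)) has_real_derivative pd1 f (x, v)) (at x)"
      using smooth_on_has_partial_derivatives(1)[OF assms(2)] inU[OF x] v by auto
    have "((\<lambda>u. f (u, d) + integral {d..v} (\<lambda>t. pd2 f (u, t))) has_real_derivative
        pd1 f (x, d) + integral {d..v} (\<lambda>t. pd1 (pd2 f) (x, t))) (at x)"
      using v inU[OF x]
      by (intro DERIV_add smooth_on_has_partial_derivatives(1)[OF assms(2)]
          has_real_derivative_integral_parameter[OF assms(1) f2 R(1) x]) auto
    then show "((\<lambda>u. f (u, v)) has_real_derivative
        pd1 f (x, d) + integral {d..v} (\<lambda>t. pd1 (pd2 f) (x, t))) (at x)"
      by (rule has_field_derivative_transform_within_open[of _ _ _ "{c<..<c'}"]) (use x int v in auto)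
  qed
  have "continuous_on {d..d'} (\<lambda>t. pd1 (pd2 f) (x, t))"
    using inU[OF x]
    by (intro continuous_on_compose2[OF smooth_on_imp_continuous_on[OF smooth_on_pd(1)[OF assms(1) f2]]]
        continuous_intros) auto
  from DERIV_add[OF DERIV_const has_real_derivative_integral_upper_bound[OF this y]]
  have "((\<lambda>v. pd1 f (x, d) + integral {d..v} (\<lambda>t. pd1 (pd2 f) (x, t))) has_real_derivative
      pd1 (pd2 f) (x, y)) (at y)" by simp
  then have "((\<lambda>v. pd1 f (x, v)) has_real_derivative pd1 (pd2 f) (x, y)) (at y)"
    by (rule has_field_derivative_transform_within_open[of _ _ _ "{d<..<d'}"]) (use y pd1_int in auto)
  then show ?thesis by (simp add: p pd2_def DERIV_imp_deriv)
qed

text \<open>The form is integrated from the corner (c,d) along the bottom edge and then vertically.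
  The y-derivative of the result is b directly; for the x-derivative, closedness turns the integral
  of the x-derivative of b into a(x,y) - a(x,d).\<close>

lemma closed_form_has_potential:
  assumes "open U" "smooth_on U a" "smooth_on U b" "\<And>p. p \<in> U \<Longrightarrow> pd2 a p = pd1 b p"
    and R: "{c..c'} \<times> {d..d'} \<subseteq> U"
  obtains \<xi> where "smooth_on ({c<..<c'} \<times> {d<..<d'}) \<xi>"
    "\<And>p. p \<in> {c<..<c'} \<times> {d<..<d'} \<Longrightarrow>
      (\<xi> has_derivative (\<lambda>(dx, dy). a p * dx + b p * dy)) (at p)"
proof -
  let ?V = "{c<..<c'} \<times> {d<..<d'}"
  define X where "X x y = integral {c..x} (\<lambda>s. a (s, d)) + integral {d..y} (\<lambda>t. b (x, t))" for x y
  \<comment> \<open>The condition \<open>d \<le> d'\<close> makes the bottom edge part of the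
    rectangle and hence of \<open>U\<close>.\<close>
  have cont: "continuous_on {c..c'} (\<lambda>s. f (s, d))" if "smooth_on U f" "d \<le> d'" for f :: "real \<times> real \<Rightarrow> real"
    using R that
    by (intro continuous_on_compose2[OF smooth_on_imp_continuous_on[OF that(1)]] continuous_intros) auto
  have cont': "continuous_on {d..d'} (\<lambda>t. f (x, t))"
    if "smooth_on U f" "x \<in> {c<..<c'}" for f :: "real \<times> real \<Rightarrow> real" and x
    using R that
    by (intro continuous_on_compose2[OF smooth_on_imp_continuous_on[OF that(1)]] continuous_intros) auto
  have X2: "(X x has_real_derivative b (x, y)) (at y)" if "x \<in> {c<..<c'}" "y \<in> {d<..<d'}" for x y
    unfolding X_def
    using DERIV_add[OF DERIV_const has_real_derivative_integral_upper_bound[OF cont'[OF assms(3) that(1)] that(2)]]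
    by simp
  have X1: "((\<lambda>x. X x y) has_real_derivative a (x, y)) (at x)"
    if x: "x \<in> {c<..<c'}" and y: "y \<in> {d<..<d'}" for x y
  proof -
    have "((\<lambda>t. pd2 a (x, t)) has_integral a (x, y) - a (x, d)) {d..y}"
      using R x y
      by (intro fundamental_theorem_of_calculus)
        (auto simp flip: has_real_derivative_iff_has_vector_derivative
          intro!: has_field_derivative_at_within[OF smooth_on_has_partial_derivatives(2)[OF assms(2)]])
    moreover have "integral {d..y} (\<lambda>t. pd1 b (x, t)) = integral {d..y} (\<lambda>t. pd2 a (x, t))"
      using R x y by (intro integral_cong) (auto intro!: assms(4)[symmetric])
    ultimately have "integral {d..y} (\<lambda>t. pd1 b (x, t)) = a (x, y) - a (x, d)"
      by (simp add: integral_unique)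
    moreover have "((\<lambda>x. X x y) has_real_derivative a (x, d) + integral {d..y} (\<lambda>t. pd1 b (x, t))) (at x)"
      unfolding X_def using x y
      by (intro DERIV_add has_real_derivative_integral_upper_bound[OF cont[OF assms(2)]]
          has_real_derivative_integral_parameter[OF assms(1,3) R]) auto
    ultimately show ?thesis by simp
  qed
  have der: "((\<lambda>(x, y). X x y) has_derivative (\<lambda>(dx, dy). a p * dx + b p * dy)) (at p)"
    if "p \<in> ?V" for p
  proof -
    obtain x y where p: "p = (x, y)" by fastforce
    then have x: "x \<in> {c<..<c'}" and y: "y \<in> {d<..<d'}" using that by auto
    have op: "open ?V" by (intro open_Times) auto
    \<comment> \<open>Existence of both partial derivatives does not yet give the total one;
      continuity of the second partial derivative supplies what
      \<open>has_derivative_partialsI\<close> asks for.\<close>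
    have "continuous_on ?V b"
      by (rule continuous_on_subset[OF smooth_on_imp_continuous_on[OF assms(3)]]) (use R in auto)
    then have "continuous (at (x, y) within ?V) (\<lambda>(x, y). blinfun_mult_right (b (x, y)))"
      using x y unfolding case_prod_beta' prod.collapse
      by (intro bounded_linear.continuous[OF bounded_linear_blinfun_mult_right])
        (auto simp: continuous_on_eq_continuous_within)
    then have "((\<lambda>(x, y). X x y) has_derivative
        (\<lambda>(dx, dy). a (x, y) * dx + blinfun_mult_right (b (x, y)) dy)) (at (x, y) within ?V)"
      using x y X1 X2
      by (intro has_derivative_partialsI)
        (auto simp: has_field_derivative_def intro: has_derivative_at_withinI[of _ _ _ "{_<..<_}"])
    then show ?thesis using at_within_open[OF that op] p by simp
  qed
  have "?V \<subseteq> U" using R by auto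
  then have "smooth_on ?V a" "smooth_on ?V b" using assms(2,3) by (auto intro: smooth_on_subset)
  then have "smooth_on ?V (\<lambda>p. case v of (dx, dy) \<Rightarrow> a p * dx + b p * dy)" for v :: "real \<times> real"
    unfolding case_prod_beta by (intro smooth_intros open_Times) auto
  from that[OF smooth_onI[OF _ der this]] der show thesis by (auto simp: open_Times)
qed

subsection \<open>The characteristic derivatives\<close>

text \<open>\<open>log_equation\<close> is the constant astigmatism equation for z = e^(2w),
  multiplied by e^(2w)/2. Its second-order part w_xx - e^(4w) w_yy is that of the product of the two
  characteristic derivatives.\<close>

locale constant_astigmatism =
  fixes U :: "(real \<times> real) set" and w :: "real \<times> real \<Rightarrow> real"
  assumes open_U: "open U" and smooth_w: "smooth_on U w"
    and log_equation: "p \<in> U \<Longrightarrow> pd1 (pd1 w) p - (exp (2 * w p))\<^sup>2 * pd2 (pd2 w) p =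
      2 * (pd1 w p)\<^sup>2 + 2 * (exp (2 * w p))\<^sup>2 * (pd2 w p)\<^sup>2 + exp (2 * w p)"
begin

text \<open>The parameter \<open>e\<close> is the sign \<open>\<plusminus>1\<close>; \<open>D e w\<close> is \<open>P\<^sub>\<plusminus>\<close>.\<close>

definition D :: "real \<Rightarrow> (real \<times> real \<Rightarrow> real) \<Rightarrow> real \<times> real \<Rightarrow> real" where
  "D e f p = pd1 f p + e * (exp (2 * w p) * pd2 f p)"

definition R :: "real \<Rightarrow> real \<times> real \<Rightarrow> real" where
  "R e p = sqrt ((D e w p)\<^sup>2 + exp (2 * w p))"

definition \<theta> :: "real \<Rightarrow> real \<times> real \<Rightarrow> real" where
  "\<theta> e p = arctan (D e w p * exp (- w p))"

definition angle :: "real \<times> real \<Rightarrow> real" where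
  "angle p = \<theta> 1 p + \<theta> (- 1) p - pi"

section \<open>Rules for the characteristic derivatives and their commutator\<close>

lemma D_add:
  assumes "f differentiable (at p)" "g differentiable (at p)"
  shows "D e (\<lambda>q. f q + g q) p = D e f p + D e g p"
  by (simp add: D_def pd_add[OF assms] algebra_simps)

lemma D_mult:
  assumes "f differentiable (at p)" "g differentiable (at p)"
  shows "D e (\<lambda>q. f q * g q) p = f p * D e g p + D e f p * g p"
  by (simp add: D_def pd_mult[OF assms] algebra_simps)

lemma D_chain:
  assumes "f differentiable (at p)" "(h has_real_derivative h') (at (f p))"
  shows "D e (\<lambda>q. h (f q)) p = h' * D e f p"
  by (simp add: D_def pd_chain[OF assms] algebra_simps)

lemma D_const [simp]: "D e (\<lambda>q. c) p = 0"
  by (simp add: D_def)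

lemma D_cong:
  assumes "open S" "p \<in> S" "\<And>q. q \<in> S \<Longrightarrow> f q = g q" "f differentiable (at p)"
  shows "D e g p = D e f p"
  by (simp add: D_def pd_cong[OF assms])

lemma smooth_exp_w: "smooth_on U (\<lambda>p. exp (c * w p))"
  using open_U smooth_w by (intro smooth_intros)

lemma smooth_D:
  assumes "smooth_on U f"
  shows "smooth_on U (D e f)"
  unfolding D_def[abs_def]
  using open_U smooth_w assms by (intro smooth_intros smooth_on_pd)

lemmas differentiable = smooth_on_imp_differentiable[of U]

lemma D_exp_w:
  assumes "p \<in> U"
  shows "D e (\<lambda>q. exp (c * w q)) p = c * exp (c * w p) * D e w p"
  by (rule D_chain[OF differentiable[OF smooth_w assms]]) (auto intro!: derivative_eq_intros)

text \<open>The last summand appears because the coefficient e^(2w) of \<open>D b\<close> is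
  differentiated too.\<close>

lemma D_D:
  assumes "smooth_on U f" "p \<in> U"
  shows "D a (D b f) p = D a (pd1 f) p +
    b * (exp (2 * w p) * D a (pd2 f) p + 2 * exp (2 * w p) * D a w p * pd2 f p)"
proof -
  have d: "pd1 f differentiable (at p)" "pd2 f differentiable (at p)"
    "(\<lambda>q. exp (2 * w q)) differentiable (at p)"
    "(\<lambda>q. exp (2 * w q) * pd2 f q) differentiable (at p)"
    "(\<lambda>q. b * (exp (2 * w q) * pd2 f q)) differentiable (at p)"
    using smooth_on_pd[OF open_U assms(1)]
    by (auto intro!: differentiable assms smooth_intros open_U smooth_exp_w smooth_w)
  show ?thesis
    unfolding D_def[of b, abs_def]
    by (simp add: D_add D_mult D_exp_w d assms(2))
qed

text \<open>The second-order terms cancel by \<open>pd_commute\<close>. What remains are derivatives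
  of the coefficient e^(2w); they combine through D_e w + D_(-e) w = 2 w_x, and 2 e e^(2w) f_y = D_e
  f - D_(-e) f.\<close>

lemma D_commute:
  assumes "smooth_on U f" "p \<in> U"
  shows "D (- e) (D e f) p = D e (D (- e) f) p + 2 * pd1 w p * (D e f p - D (- e) f p)"
  unfolding D_D[OF assms]
  by (simp add: D_def pd_commute[OF open_U assms] algebra_simps)

lemma smooth_R: "smooth_on U (R e)"
  unfolding R_def[abs_def]
  using open_U smooth_D[OF smooth_w] smooth_w
  by (intro smooth_intros) (auto intro: add_nonneg_pos)

lemma smooth_\<theta>: "smooth_on U (\<theta> e)"
  unfolding \<theta>_def[abs_def] using open_U smooth_D[OF smooth_w] smooth_w by (intro smooth_intros)

lemma smooth_angle: "smooth_on U angle"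
  unfolding angle_def[abs_def] using open_U smooth_\<theta> by (intro smooth_intros)

section \<open>The radius R and the trigonometry of \<theta>\<close>

lemma R_pos: "R e p > 0"
  by (simp add: R_def add_nonneg_pos)

lemma R_square: "(R e p)\<^sup>2 = (D e w p)\<^sup>2 + exp (2 * w p)"
  by (simp add: R_def add_nonneg_pos less_imp_le)

lemma exp_w_square: "exp (w p) * exp (w p) = exp (2 * w p)"
  by (simp flip: exp_add)

text \<open>This is the secant of \<open>\<theta> e p\<close>, the denominator in the sine and
  cosine of an arctangent.\<close>

lemma sqrt_tan_\<theta>: "sqrt (1 + (D e w p * exp (- w p))\<^sup>2) = R e p * exp (- w p)"
proof (rule real_sqrt_unique)
  have "(R e p * exp (- w p))\<^sup>2 = ((D e w p)\<^sup>2 + exp (2 * w p)) * (exp (- w p))\<^sup>2"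
    by (simp add: power_mult_distrib R_square)
  also have "\<dots> = 1 + (D e w p * exp (- w p))\<^sup>2"
    by (simp add: algebra_simps power_mult_distrib flip: exp_add exp_double)
  finally show "(R e p * exp (- w p))\<^sup>2 = 1 + (D e w p * exp (- w p))\<^sup>2" .
qed (simp add: R_pos less_imp_le)

lemma cos_\<theta>: "cos (\<theta> e p) = exp (w p) / R e p"
  unfolding \<theta>_def cos_arctan sqrt_tan_\<theta> by (simp add: exp_minus field_simps)

lemma sin_\<theta>: "sin (\<theta> e p) = D e w p / R e p"
  unfolding \<theta>_def sin_arctan sqrt_tan_\<theta> by (simp add: exp_minus field_simps)

section \<open>Consequences of the equation for each sign\<close>

context
  fixes e :: real and p :: "real \<times> real"
  assumes e: "e * e = 1" and p: "p \<in> U"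
begin

text \<open>The mixed derivatives cancel, and \<open>e * e = 1\<close> makes the second-order part
  the left-hand side of \<open>log_equation\<close>. After substitution the squares of w_y cancel as
  well, leaving a multiple of D_e w.\<close>

lemma D_D_w: "D (- e) (D e w) p = 2 * pd1 w p * D e w p + exp (2 * w p)"
proof -
  have "D (- e) (D e w) p = pd1 (pd1 w) p - e * e * (exp (2 * w p))\<^sup>2 * pd2 (pd2 w) p +
      2 * e * exp (2 * w p) * pd1 w p * pd2 w p - 2 * (e * e) * (exp (2 * w p))\<^sup>2 * (pd2 w p)\<^sup>2"
    unfolding D_D[OF smooth_w p]
    by (simp add: D_def pd_commute[OF open_U smooth_w p] algebra_simps power2_eq_square)
  then show ?thesis
    using log_equation[OF p] by (simp add: e D_def algebra_simps power2_eq_square)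
qed

lemma D_minus_w: "D (- e) w p = 2 * pd1 w p - D e w p"
  by (simp add: D_def)

text \<open>For u = e^(-w) P, the identity for P gives D_(-e) u = e^(-w) R^2, while 1 + u^2 =
  e^(-2w) R^2; their quotient is e^w.\<close>

lemma D_\<theta>: "D (- e) (\<theta> e) p = exp (w p)"
proof -
  let ?P = "D e w p" and ?u = "D e w p * exp (- w p)"
  have d: "D e w differentiable (at p)" "(\<lambda>q. exp (- 1 * w q)) differentiable (at p)"
    "(\<lambda>q. D e w q * exp (- w q)) differentiable (at p)"
    by (auto intro!: differentiable p smooth_intros open_U smooth_D smooth_w)
  have "D (- e) (\<lambda>q. D e w q * exp (- 1 * w q)) p
      = ?P * (- exp (- w p) * (2 * pd1 w p - ?P)) + (2 * pd1 w p * ?P + exp (2 * w p)) * exp (- w p)"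
    using D_mult[OF d(1,2), of "- e"] D_exp_w[OF p, of "- e" "- 1"] by (simp add: D_D_w D_minus_w)
  also have "\<dots> = (?P\<^sup>2 + exp (2 * w p)) * exp (- w p)"
    by (simp add: algebra_simps power2_eq_square)
  finally have 1: "D (- e) (\<lambda>q. D e w q * exp (- w q)) p = (R e p)\<^sup>2 * exp (- w p)"
    by (simp add: R_square)
  have "1 + ?u\<^sup>2 = (R e p * exp (- w p))\<^sup>2"
    by (simp flip: sqrt_tan_\<theta>)
  then have 2: "1 + ?u\<^sup>2 = (R e p)\<^sup>2 * exp (- w p) * exp (- w p)"
    by (simp add: power2_eq_square)
  have "D (- e) (\<theta> e) p = inverse (1 + ?u\<^sup>2) * D (- e) (\<lambda>q. D e w q * exp (- w q)) p"
    unfolding \<theta>_def[abs_def] by (rule D_chain[OF d(3)]) (rule DERIV_arctan)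
  also have "\<dots> = exp (w p)"
    unfolding 1 2 using R_pos[of e p] by (simp add: exp_minus field_simps)
  finally show ?thesis .
qed

text \<open>Differentiating R^2 = P^2 + e^(2w), the two terms 2 P e^(2w) cancel and 4 w_x R^2 is
  left.\<close>

lemma D_R: "D (- e) (R e) p = 2 * pd1 w p * R e p"
proof -
  let ?P = "D e w p"
  have d: "D e w differentiable (at p)" "(\<lambda>q. exp (2 * w q)) differentiable (at p)"
    "(\<lambda>q. D e w q * D e w q) differentiable (at p)"
    "(\<lambda>q. D e w q * D e w q + exp (2 * w q)) differentiable (at p)"
    by (auto intro!: differentiable p smooth_intros open_U smooth_D smooth_w)
  have "D (- e) (\<lambda>q. D e w q * D e w q + exp (2 * w q)) p = 4 * pd1 w p * (R e p)\<^sup>2"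
    by (simp add: D_add D_mult D_exp_w d p D_D_w D_minus_w R_square)
      (simp add: algebra_simps power2_eq_square)
  moreover have "D (- e) (R e) p =
      inverse (R e p) / 2 * D (- e) (\<lambda>q. D e w q * D e w q + exp (2 * w q)) p"
    unfolding R_def[abs_def] power2_eq_square
    by (rule D_chain[OF d(4)]) (auto intro!: DERIV_real_sqrt add_nonneg_pos)
  ultimately show ?thesis
    using R_pos[of e p] by (simp add: field_simps power2_eq_square)
qed

end

section \<open>A particular angle and its sine-Gordon equation along characteristics\<close>

lemma sin_cos_angle:
  "cos (angle p) = (D 1 w p * D (- 1) w p - exp (2 * w p)) / (R 1 p * R (- 1) p)"
  "sin (angle p) = - (2 * exp (w p) * pd1 w p / (R 1 p * R (- 1) p))"
proof -
  \<comment> \<open>The shift by \<pi> flips both signs. The addition formulas then yield the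
    prescribed values, the sine by P_+ + P_- = 2 w_x.\<close>
  have "cos (angle p) = - cos (\<theta> 1 p + \<theta> (- 1) p)" "sin (angle p) = - sin (\<theta> 1 p + \<theta> (- 1) p)"
    by (simp_all add: angle_def)
  then show "cos (angle p) = (D 1 w p * D (- 1) w p - exp (2 * w p)) / (R 1 p * R (- 1) p)"
    "sin (angle p) = - (2 * exp (w p) * pd1 w p / (R 1 p * R (- 1) p))"
    using R_pos[of 1 p] R_pos[of "- 1" p] exp_w_square[of p]
    by (simp_all add: cos_add sin_add cos_\<theta> sin_\<theta> D_def field_simps)
qed

lemma D_angle:
  assumes "p \<in> U"
  shows "D 1 angle p = D 1 (\<theta> 1) p + exp (w p)"
proof -
  have "D 1 angle p = D 1 (\<theta> 1) p + D 1 (\<theta> (- 1)) p"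
    unfolding angle_def[abs_def] diff_conv_add_uminus
    by (simp add: D_add differentiable[OF _ assms] smooth_on_add smooth_\<theta> open_U smooth_on_const
        del: add_uminus_conv_diff)
  then show ?thesis using D_\<theta>[of "- 1" p] assms by simp
qed

text \<open>The quantity t = D_+ \<theta>_+ is not determined by the equation, but it drops out: D_-
  (t + e^w) = 2 w_x t and D_- (1/R_+) = -2 w_x / R_+, so the derivative of the quotient (t + e^w) /
  R_+ is -2 e^w w_x / R_+.\<close>

lemma sine_gordon_characteristic:
  assumes p: "p \<in> U"
  shows "D (- 1) (\<lambda>q. D 1 angle q / R 1 q) p / R (- 1) p = sin (angle p)"
proof -
  let ?wx = "pd1 w p" and ?t = "D 1 (\<theta> 1) p"
  have dw: "(\<lambda>q. exp (w q)) differentiable (at p)" "D 1 (\<theta> 1) differentiable (at p)"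
    "D 1 angle differentiable (at p)" "R 1 differentiable (at p)"
    "(\<lambda>q. inverse (R 1 q)) differentiable (at p)"
    using R_pos
    by (auto intro!: differentiable p smooth_intros smooth_on_inverse smooth_D smooth_\<theta> smooth_angle
        smooth_R smooth_w open_U)
  have exp_w: "D e (\<lambda>q. exp (w q)) p = exp (w p) * D e w p" for e
    using D_exp_w[OF p, of e 1] by simp
  have "D 1 (D (- 1) (\<theta> 1)) p = D 1 (\<lambda>q. exp (w q)) p"
    by (rule D_cong[OF open_U p _ dw(1)]) (simp add: D_\<theta>)
  \<comment> \<open>The commutator replaces D_- D_+ \<theta>_+ by D_+ D_- \<theta>_+, where D_-
    \<theta>_+ is known to be e^w.\<close>
  then have 1: "D (- 1) (D 1 (\<theta> 1)) p = exp (w p) * D 1 w p + 2 * ?wx * (?t - exp (w p))"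
    using D_commute[OF smooth_\<theta> p, of 1] D_\<theta>[of 1 p] p by (simp add: exp_w)
  have "D (- 1) (D 1 angle) p = D (- 1) (\<lambda>q. D 1 (\<theta> 1) q + exp (w q)) p"
    by (rule D_cong[OF open_U p]) (use dw D_angle in auto)
  also have "\<dots> = 2 * ?wx * ?t"
    by (simp add: D_add dw 1 exp_w) (simp add: D_def algebra_simps)
  finally have 2: "D (- 1) (D 1 angle) p = 2 * ?wx * ?t" .
  have "D (- 1) (\<lambda>q. inverse (R 1 q)) p = - inverse ((R 1 p)\<^sup>2) * D (- 1) (R 1) p"
    by (rule D_chain[OF dw(4)]) (use R_pos[of 1 p] in \<open>auto intro!: derivative_eq_intros simp: power2_eq_square\<close>)
  also have "\<dots> = - (2 * ?wx * inverse (R 1 p))"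
    using D_R[of 1 p] p R_pos[of 1 p] by (simp add: field_simps power2_eq_square)
  finally have 3: "D (- 1) (\<lambda>q. inverse (R 1 q)) p = - (2 * ?wx * inverse (R 1 p))" .
  have "D (- 1) (\<lambda>q. D 1 angle q / R 1 q) p = - (2 * exp (w p) * ?wx / R 1 p)"
    unfolding divide_inverse
    by (simp add: D_mult dw 2 3 D_angle p) (simp add: algebra_simps)
  then show ?thesis by (simp add: sin_cos_angle)
qed

section \<open>The coframe and the prescribed formulas in terms of D and R\<close>

text \<open>\<open>form 1\<close> is \<open>d\<xi>\<close> and \<open>form (- 1)\<close> is \<open>d\<eta>\<close>; \<open>coframe_inv p\<close> inverts the pair of them.\<close>

definition form :: "real \<Rightarrow> real \<times> real \<Rightarrow> real \<times> real \<Rightarrow> real" where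
  "form e p h = R e p / 2 * (fst h + e * exp (- 2 * w p) * snd h)"

definition coframe_inv :: "real \<times> real \<Rightarrow> real \<times> real \<Rightarrow> real \<times> real" where
  "coframe_inv p k = (fst k / R 1 p + snd k / R (- 1) p,
     exp (2 * w p) * (fst k / R 1 p - snd k / R (- 1) p))"

text \<open>Taking e^(-4x) out of the root shows that the dy-coefficients of both forms are, up to
  sign, e^(-2w) times the dx-coefficients, so each form is R/2 times dx + e^(-2w) dy or dx - e^(-2w)
  dy.\<close>

lemma form_coeff:
  fixes a b x :: real
  shows "sqrt ((exp (- 2 * x) * a + b)\<^sup>2 + exp (- 2 * x)) =
    exp (- 2 * x) * sqrt ((a + exp (2 * x) * b)\<^sup>2 + exp (2 * x))"
proof -
  have "(exp (- 2 * x) * a + b)\<^sup>2 + exp (- 2 * x) =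
      (exp (- 2 * x))\<^sup>2 * ((a + exp (2 * x) * b)\<^sup>2 + exp (2 * x))"
    by (simp add: exp_minus field_simps power2_eq_square)
  then show ?thesis by (simp only: real_sqrt_mult real_sqrt_abs abs_exp_cancel)
qed

lemma is_xi_iff: "is_xi V w \<xi> \<longleftrightarrow> smooth_on V \<xi> \<and> (\<forall>p\<in>V. (\<xi> has_derivative form 1 p) (at p))"
proof -
  have "(\<lambda>(dx, dy). 1 / 2 * sqrt ((pd1 w p + exp (2 * w p) * pd2 w p)\<^sup>2 + exp (2 * w p)) * dx +
      1 / 2 * sqrt ((exp (- 2 * w p) * pd1 w p + pd2 w p)\<^sup>2 + exp (- 2 * w p)) * dy) = form 1 p" for p
    unfolding form_coeff by (auto simp: form_def R_def D_def fun_eq_iff algebra_simps)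
  then show ?thesis unfolding is_xi_def by (simp only:)
qed

lemma is_eta_iff: "is_eta V w \<eta> \<longleftrightarrow> smooth_on V \<eta> \<and> (\<forall>p\<in>V. (\<eta> has_derivative form (- 1) p) (at p))"
proof -
  have "sqrt ((exp (- 2 * w p) * pd1 w p - pd2 w p)\<^sup>2 + exp (- 2 * w p)) = exp (- 2 * w p) * R (- 1) p" for p
    using form_coeff[of "w p" "pd1 w p" "- pd2 w p"] by (simp add: R_def D_def)
  then have "(\<lambda>(dx, dy). 1 / 2 * sqrt ((pd1 w p - exp (2 * w p) * pd2 w p)\<^sup>2 + exp (2 * w p)) * dx -
      1 / 2 * sqrt ((exp (- 2 * w p) * pd1 w p - pd2 w p)\<^sup>2 + exp (- 2 * w p)) * dy) = form (- 1) p" for p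
    by (auto simp: form_def R_def D_def fun_eq_iff algebra_simps)
  then show ?thesis unfolding is_eta_def by (simp only:)
qed

text \<open>The prescribed numerator of the cosine is a difference of squares minus e^(2w), namely
  P_+ P_- - e^(2w), and the two roots are R_+ and R_-.\<close>

lemma is_angle_iff:
  "is_angle V w \<phi> \<longleftrightarrow> smooth_on V \<phi> \<and> (\<forall>p\<in>V. cos (\<phi> p) = cos (angle p) \<and> sin (\<phi> p) = sin (angle p))"
proof -
  have "(pd1 w p)\<^sup>2 - exp (2 * w p) - exp (4 * w p) * (pd2 w p)\<^sup>2 = D 1 w p * D (- 1) w p - exp (2 * w p)" for p
  proof -
    have "exp (4 * w p) = exp (2 * w p) * exp (2 * w p)" by (simp flip: exp_add)
    then show ?thesis by (simp add: D_def algebra_simps power2_eq_square)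
  qed
  moreover have "sqrt ((pd1 w p + exp (2 * w p) * pd2 w p)\<^sup>2 + exp (2 * w p)) = R 1 p"
    "sqrt ((pd1 w p - exp (2 * w p) * pd2 w p)\<^sup>2 + exp (2 * w p)) = R (- 1) p" for p
    by (simp_all add: R_def D_def)
  ultimately show ?thesis unfolding is_angle_def sin_cos_angle by (simp only:)
qed

text \<open>On \<open>V\<close> the difference of the two angles has sine 0 and cosine 1.
  Differentiating the vanishing sine, with the cosine as factor, shows that both angles have the
  same differential.\<close>

lemma D_eq_D_angle:
  assumes V: "open V" "V \<subseteq> U" and \<phi>: "is_angle V w \<phi>" and p: "p \<in> V"
  shows "D e \<phi> p = D e angle p"
proof -
  let ?d\<phi> = "frechet_derivative \<phi> (at p)" and ?d\<psi> = "frechet_derivative angle (at p)"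
  have d: "(\<phi> has_derivative ?d\<phi>) (at p)" "(angle has_derivative ?d\<psi>) (at p)"
    using \<phi> smooth_angle p V(2) unfolding is_angle_iff by (auto intro: smooth_on_has_derivative)
  have sc: "sin (\<phi> q - angle q) = 0" "cos (\<phi> q - angle q) = 1" if "q \<in> V" for q
    using \<phi> that sin_cos_squared_add3[of "angle q"] unfolding is_angle_iff
    by (simp_all add: sin_diff cos_diff)
  have "((\<lambda>q. sin (\<phi> q - angle q)) has_derivative (\<lambda>h. ?d\<phi> h - ?d\<psi> h)) (at p)"
    using d sc(2)[OF p] by (auto intro!: derivative_eq_intros)
  moreover have "((\<lambda>q. sin (\<phi> q - angle q)) has_derivative (\<lambda>h. 0)) (at p)"
    by (rule has_derivative_transform_within_open[OF has_derivative_const V(1) p]) (simp add: sc)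
  ultimately have "(\<lambda>h. ?d\<phi> h - ?d\<psi> h) = (\<lambda>h. 0)" by (rule has_derivative_unique)
  then have "?d\<phi> = ?d\<psi>" by (simp add: fun_eq_iff)
  then show ?thesis by (simp add: D_def pd_eq_derivative[OF d(1)] pd_eq_derivative[OF d(2)])
qed

section \<open>Local existence of \<xi>, \<eta> and the angle\<close>

lemma exists_potential:
  assumes e: "e * e = 1" and rect: "{c..c'} \<times> {d..d'} \<subseteq> U"
  obtains \<xi> where "smooth_on ({c<..<c'} \<times> {d<..<d'}) \<xi>"
    "\<And>p. p \<in> {c<..<c'} \<times> {d<..<d'} \<Longrightarrow> (\<xi> has_derivative form e p) (at p)"
proof -
  let ?a = "\<lambda>p. 1 / 2 * R e p" and ?b = "\<lambda>p. e / 2 * (exp (- 2 * w p) * R e p)"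
  have smooth: "smooth_on U ?a" "smooth_on U ?b"
    using open_U smooth_R smooth_w by (auto intro!: smooth_intros)
  have closed: "pd2 ?a p = pd1 ?b p" if p: "p \<in> U" for p
  proof -
    have d: "R e differentiable (at p)" "(\<lambda>q. exp (- 2 * w q)) differentiable (at p)"
      "(\<lambda>q. exp (- 2 * w q) * R e q) differentiable (at p)"
      using open_U smooth_R smooth_w by (auto intro!: differentiable p smooth_intros)
    have exp': "pd1 (\<lambda>q. exp (- 2 * w q)) p = - 2 * exp (- 2 * w p) * pd1 w p"
      by (rule pd_chain[OF differentiable[OF smooth_w p]]) (auto intro!: derivative_eq_intros)
    have "pd1 ?b p = e / 2 * exp (- 2 * w p) * (pd1 (R e) p - 2 * pd1 w p * R e p)"
      unfolding pd_mult[OF differentiable_const d(3)] pd_mult[OF d(2,1)] pd_const exp'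
      by (simp add: algebra_simps)
    \<comment> \<open>\<open>D_R\<close>, solved for the x-derivative of R, is exactly the
      closedness of the form.\<close>
    also have "pd1 (R e) p - 2 * pd1 w p * R e p = e * exp (2 * w p) * pd2 (R e) p"
      using D_R[OF e p] by (simp add: D_def)
    also have "e / 2 * exp (- 2 * w p) * (e * exp (2 * w p) * pd2 (R e) p) = 1 / 2 * pd2 (R e) p"
      using e by (simp add: exp_minus field_simps)
    finally show ?thesis unfolding pd_mult[OF differentiable_const d(1)] pd_const by simp
  qed
  obtain \<xi> where \<xi>: "smooth_on ({c<..<c'} \<times> {d<..<d'}) \<xi>"
    "\<And>p. p \<in> {c<..<c'} \<times> {d<..<d'} \<Longrightarrow>
      (\<xi> has_derivative (\<lambda>(dx, dy). ?a p * dx + ?b p * dy)) (at p)"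
    using closed_form_has_potential[OF open_U smooth closed rect] by metis
  have "(\<lambda>(dx, dy). ?a p * dx + ?b p * dy) = form e p" for p
    by (auto simp: form_def algebra_simps)
  with \<xi> show thesis by (intro that) simp_all
qed

lemma exists_angle_xi_eta:
  assumes "p \<in> U"
  shows "\<exists>V \<phi> \<xi> \<eta>. open V \<and> p \<in> V \<and> V \<subseteq> U \<and> is_angle V w \<phi> \<and> is_xi V w \<xi> \<and> is_eta V w \<eta>"
proof -
  obtain c c' d d' where rect: "{c..c'} \<times> {d..d'} \<subseteq> U" "p \<in> {c<..<c'} \<times> {d<..<d'}"
    using open_contains_rectangle[OF open_U assms] .
  let ?V = "{c<..<c'} \<times> {d<..<d'}"
  have V: "open ?V" "?V \<subseteq> U" using rect(1) by (auto simp: open_Times)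
  obtain \<xi> where "smooth_on ?V \<xi>" "\<And>p. p \<in> ?V \<Longrightarrow> (\<xi> has_derivative form 1 p) (at p)"
    using exists_potential[OF _ rect(1), of 1] by auto
  then have "is_xi ?V w \<xi>" by (simp add: is_xi_iff)
  moreover
  obtain \<eta> where "smooth_on ?V \<eta>" "\<And>p. p \<in> ?V \<Longrightarrow> (\<eta> has_derivative form (- 1) p) (at p)"
    using exists_potential[OF _ rect(1), of "- 1"] by auto
  then have "is_eta ?V w \<eta>" by (simp add: is_eta_iff)
  moreover have "is_angle ?V w angle"
    using smooth_on_subset[OF smooth_angle V(2)] by (simp add: is_angle_iff)
  ultimately show ?thesis using V rect(2) by blast
qed

section \<open>The dual frame\<close>

lemma coframe_inv_right: "(form 1 p (coframe_inv p k), form (- 1) p (coframe_inv p k)) = k"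
  using R_pos[of 1 p] R_pos[of "- 1" p]
  by (cases k) (simp add: form_def coframe_inv_def exp_minus field_simps)

lemma coframe_inv_left: "coframe_inv p (form 1 p h, form (- 1) p h) = h"
  using R_pos[of 1 p] R_pos[of "- 1" p]
  by (cases h) (simp add: form_def coframe_inv_def exp_minus field_simps)

lemma smooth_coframe_inv: "smooth_on U (\<lambda>p. coframe_inv p k)"
  unfolding coframe_inv_def using open_U smooth_R smooth_w R_pos
  by (auto intro!: smooth_on_Pair smooth_intros)

lemma bounded_linear_coframe_inv: "bounded_linear (coframe_inv p)"
  unfolding coframe_inv_def[abs_def]
  by (intro bounded_linear_Pair bounded_linear_add bounded_linear_sub bounded_linear_const_mult
      bounded_linear_compose[OF bounded_linear_divide] bounded_linear_fst bounded_linear_snd)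

text \<open>The images of (1,0) and (0,1) under \<open>coframe_inv p\<close> are the vectors of the
  dual frame, that is, the coordinate fields of \<xi> and \<eta>.\<close>

lemma derivative_coframe_inv:
  assumes "(f has_derivative f') (at p)"
  shows "f' (coframe_inv p (1, 0)) = D 1 f p / R 1 p"
    and "f' (coframe_inv p (0, 1)) = D (- 1) f p / R (- 1) p"
proof -
  have f': "f' h = pd1 f p * fst h + pd2 f p * snd h" for h
    using has_derivative_unique[OF assms has_derivative_pd[OF assms]] by (rule fun_cong)
  show "f' (coframe_inv p (1, 0)) = D 1 f p / R 1 p"
    and "f' (coframe_inv p (0, 1)) = D (- 1) f p / R (- 1) p"
    unfolding f' by (simp_all add: coframe_inv_def D_def add_divide_distrib diff_divide_distrib)
qed

section \<open>The coordinate change and the equation in the new coordinates\<close>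

context
  fixes V \<xi> \<eta>
  assumes V: "open V" "V \<subseteq> U" and xi: "is_xi V w \<xi>" and eta: "is_eta V w \<eta>"
begin

lemma coord_map_has_derivative:
  "p \<in> V \<Longrightarrow> (coord_map \<xi> \<eta> has_derivative (\<lambda>h. (form 1 p h, form (- 1) p h))) (at p)"
  unfolding coord_map_def[abs_def]
  using xi eta unfolding is_xi_iff is_eta_iff by (intro has_derivative_Pair) auto

lemma smooth_coord_map: "smooth_on V (coord_map \<xi> \<eta>)"
  unfolding coord_map_def[abs_def]
  using xi eta V unfolding is_xi_iff is_eta_iff by (intro smooth_on_Pair) auto

text \<open>The coframe is invertible, so the inverse function theorem provides a differentiable
  local inverse. Its derivative at y is \<open>coframe_inv (g y)\<close>, an autonomous equation
  with smooth right-hand side, and bootstrapping makes the inverse smooth.\<close>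

lemma exists_coordinates:
  assumes p: "p \<in> V"
  shows "\<exists>W. p \<in> W \<and> W \<subseteq> V \<and> coordinates_on W \<xi> \<eta>"
proof -
  let ?F = "coord_map \<xi> \<eta>" and ?dF = "\<lambda>q h. (form 1 q h, form (- 1) q h)"
  let ?F' = "\<lambda>q. Blinfun (?dF q)"
  have F': "blinfun_apply (?F' q) = ?dF q" if "q \<in> V" for q
    by (rule bounded_linear_Blinfun_apply[OF has_derivative_bounded_linear[OF coord_map_has_derivative[OF that]]])
  have "continuous_on V (\<lambda>q. form e q h)" for e h
    unfolding form_def
    using smooth_on_imp_continuous_on[OF smooth_on_subset[OF smooth_R V(2)]]
      smooth_on_imp_continuous_on[OF smooth_on_subset[OF smooth_w V(2)]]
    by (auto intro!: continuous_intros)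
  then have "continuous_on V (\<lambda>q. ?dF q h)" for h
    by (intro continuous_on_Pair)
  then have "continuous_on V (\<lambda>q. blinfun_apply (?F' q) h)" for h
    by (rule continuous_on_eq) (simp add: F')
  \<comment> \<open>In finite dimension, continuity at each fixed vector gives continuity in the
    operator norm.\<close>
  then have cont: "continuous_on V ?F'" by (rule continuous_on_blinfun_componentwise)
  have inv: "Blinfun (coframe_inv p) o\<^sub>L ?F' p = id_blinfun"
    by (rule blinfun_eqI)
      (simp add: F'[OF p] bounded_linear_Blinfun_apply[OF bounded_linear_coframe_inv] coframe_inv_left)
  have der: "(?F has_derivative blinfun_apply (?F' q)) (at q)" if "q \<in> V" for q
    using coord_map_has_derivative[OF that] by (simp add: F'[OF that])
  show ?thesis
  proof (rule inverse_function_theorem[OF V(1) der cont p inv])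
    fix W T g g'
    assume W: "open W" "W \<subseteq> V" "p \<in> W" and T: "open T" and hom: "homeomorphism W T ?F g"
      and g: "\<And>y. y \<in> T \<Longrightarrow> (g has_derivative (g' y)) (at y)"
        "\<And>y. y \<in> T \<Longrightarrow> g' y = inv (blinfun_apply (?F' (g y)))"
    have T_eq: "T = ?F ` W" and gT: "g ` T = W" and gF: "\<And>q. q \<in> W \<Longrightarrow> g (?F q) = q"
      using hom by (auto simp: homeomorphism_def)
    have "(g has_derivative coframe_inv (g y)) (at y)" if y: "y \<in> T" for y
    proof -
      have "g y \<in> V" using gT W(2) y by auto
      then have "g' y = inv (?dF (g y))" by (simp add: g(2)[OF y] F')
      also have "\<dots> = coframe_inv (g y)"
        by (rule inv_equality) (simp_all only: coframe_inv_left coframe_inv_right)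
      finally show ?thesis using g(1)[OF y] by simp
    qed
    then have smooth_g: "smooth_on T g"
      by (rule smooth_on_autonomous[OF T V(1) _ _ smooth_on_subset[OF smooth_coframe_inv V(2)]])
        (use gT W(2) in auto)
    have inj: "inj_on ?F W" using gF by (rule inj_on_inverseI)
    have "smooth_on T (inv_into W ?F)"
      by (rule smooth_on_cong[OF T smooth_g]) (auto simp: T_eq gF inv_into_f_f[OF inj])
    then have "coordinates_on W \<xi> \<eta>"
      unfolding coordinates_on_def
      using W(1) T inj smooth_on_subset[OF smooth_coord_map W(2)] by (simp add: T_eq)
    with W show ?thesis by blast
  qed
qed

text \<open>Through the inverse \<open>g\<close>, the \<xi>- and \<eta>-derivatives become D_+ / R_+
  and D_- / R_-. Applying them in turn leads to the identity along characteristics at the point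
  \<open>g q\<close>.\<close>

lemma sine_gordon_in_coordinates:
  assumes angle: "is_angle V w \<phi>" and "W \<subseteq> V" and W: "coordinates_on W \<xi> \<eta>"
  shows "sine_gordon_solution (coord_map \<xi> \<eta> ` W) (in_coordinates W \<xi> \<eta> \<phi>)"
proof -
  let ?F = "coord_map \<xi> \<eta>"
  define g where "g = inv_into W ?F"
  define T where "T = ?F ` W"
  have T: "open T" and smooth_g: "smooth_on T g"
    using W by (auto simp: coordinates_on_def g_def T_def)
  have gV: "g q \<in> V" if "q \<in> T" for q
    using that inv_into_into[of q ?F W] \<open>W \<subseteq> V\<close> by (auto simp: g_def T_def)
  \<comment> \<open>The derivative of \<open>g\<close> is found by differentiating the identity
    \<open>?F (g y) = y\<close> and inverting the coframe.\<close>
  have der_g: "(g has_derivative coframe_inv (g q)) (at q)" if q: "q \<in> T" for q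
  proof -
    obtain g' where g': "(g has_derivative g') (at q)"
      using smooth_on_has_derivative[OF smooth_g q] by blast
    have "((\<lambda>y. ?F (g y)) has_derivative (\<lambda>k. (form 1 (g q) (g' k), form (- 1) (g q) (g' k)))) (at q)"
      by (rule has_derivative_compose[OF g' coord_map_has_derivative[OF gV[OF q]]])
    moreover have "((\<lambda>y. ?F (g y)) has_derivative (\<lambda>k. k)) (at q)"
      by (rule has_derivative_transform_within_open[OF has_derivative_ident T q])
        (simp add: g_def T_def f_inv_into_f)
    ultimately have "(\<lambda>k. (form 1 (g q) (g' k), form (- 1) (g q) (g' k))) = (\<lambda>k. k)"
      by (rule has_derivative_unique)
    then have "g' k = coframe_inv (g q) k" for k
      using coframe_inv_left[of "g q" "g' k"] by (metis (no_types))
    then have "g' = coframe_inv (g q)" by (rule ext)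
    with g' show ?thesis by simp
  qed
  have pd_g: "pd1 (\<lambda>y. f (g y)) q = D 1 f (g q) / R 1 (g q)"
    "pd2 (\<lambda>y. f (g y)) q = D (- 1) f (g q) / R (- 1) (g q)"
    if q: "q \<in> T" and f: "f differentiable (at (g q))" for f q
  proof -
    obtain f' where f': "(f has_derivative f') (at (g q))" using f by (auto simp: differentiable_def)
    note d = has_derivative_compose[OF der_g[OF q] f']
    show "pd1 (\<lambda>y. f (g y)) q = D 1 f (g q) / R 1 (g q)"
      "pd2 (\<lambda>y. f (g y)) q = D (- 1) f (g q) / R (- 1) (g q)"
      unfolding pd_eq_derivative[OF d] derivative_coframe_inv[OF f'] by simp_all
  qed
  have smooth_\<phi>: "smooth_on V \<phi>" using angle by (simp add: is_angle_iff)
  \<comment> \<open>\<open>G\<close> is the \<xi>-derivative of the angle, seen as a function of x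
    and y; any admissible \<open>\<phi>\<close> gives the same function on \<open>V\<close> by
    \<open>D_eq_D_angle\<close>.\<close>
  define G where "G p = D 1 angle p / R 1 p" for p
  have smooth_G: "smooth_on U G"
    unfolding G_def[abs_def]
    using open_U smooth_D[OF smooth_angle] smooth_R R_pos by (auto intro!: smooth_intros)
  have "pd2 (pd1 (\<lambda>y. \<phi> (g y))) q = sin (\<phi> (g q))" if q: "q \<in> T" for q
  proof -
    have gU: "g q \<in> U" using gV[OF q] V(2) by auto
    have "(\<lambda>y. G (g y)) differentiable (at q)"
      using has_derivative_compose[OF der_g[OF q] smooth_on_has_derivative[OF smooth_G gU]]
      by (auto simp: differentiable_def)
    moreover have "G (g y) = pd1 (\<lambda>y. \<phi> (g y)) y" if "y \<in> T" for y
      using pd_g(1)[OF that smooth_on_imp_differentiable[OF smooth_\<phi> gV[OF that]]]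
        D_eq_D_angle[OF V angle gV[OF that]] by (simp add: G_def)
    ultimately have "pd2 (pd1 (\<lambda>y. \<phi> (g y))) q = pd2 (\<lambda>y. G (g y)) q"
      by (intro pd_cong(2)[OF T q])
    also have "\<dots> = D (- 1) G (g q) / R (- 1) (g q)"
      by (rule pd_g(2)[OF q differentiable[OF smooth_G gU]])
    also have "\<dots> = sin (angle (g q))"
      unfolding G_def[abs_def] by (rule sine_gordon_characteristic[OF gU])
    also have "\<dots> = sin (\<phi> (g q))" using angle gV[OF q] by (simp add: is_angle_iff)
    finally show ?thesis .
  qed
  moreover have "smooth_on T (\<lambda>y. \<phi> (g y))"
    by (rule smooth_on_compose[OF T V(1) smooth_g smooth_\<phi>]) (use gV in auto)
  ultimately show ?thesis
    unfolding sine_gordon_solution_def in_coordinates_def o_def T_def[symmetric] g_def[symmetric]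
    using T by simp
qed

end

end

section \<open>Reduction from z to w and conclusion\<close>

theorem proposition3:
  fixes U :: "(real \<times> real) set" and z w :: "real \<times> real \<Rightarrow> real"
  assumes "constant_astigmatism_solution U z"
    and "\<forall>p\<in>U. z p > 0"
    and "w = half_ln z"
  shows "(\<forall>p\<in>U. \<exists>V \<phi> \<xi> \<eta>. open V \<and> p \<in> V \<and> V \<subseteq> U \<and>
            is_angle V w \<phi> \<and> is_xi V w \<xi> \<and> is_eta V w \<eta>) \<and>
         (\<forall>V \<phi> \<xi> \<eta>. open V \<and> V \<subseteq> U \<and>
            is_angle V w \<phi> \<and> is_xi V w \<xi> \<and> is_eta V w \<eta> \<longrightarrow>
            (\<forall>p\<in>V. \<exists>W. p \<in> W \<and> W \<subseteq> V \<and> coordinates_on W \<xi> \<eta>) \<and>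
            (\<forall>W. W \<subseteq> V \<and> coordinates_on W \<xi> \<eta> \<longrightarrow>
               sine_gordon_solution (coord_map \<xi> \<eta> ` W) (in_coordinates W \<xi> \<eta> \<phi>)))"
proof -
  have U: "open U" and smooth_z: "smooth_on U z"
    and equation: "\<And>p. p \<in> U \<Longrightarrow> pd2 (pd2 z) p + pd1 (pd1 (\<lambda>q. 1 / z q)) p + 2 = 0"
    using assms(1) by (auto simp: constant_astigmatism_solution_def)
  have smooth_w: "smooth_on U w"
    unfolding assms(3) half_ln_def[abs_def] using U smooth_z assms(2) by (auto intro!: smooth_intros)
  have z: "exp (2 * w q) = z q" if "q \<in> U" for q
    using assms(2) that by (simp add: assms(3) half_ln_def)
  have z': "exp (- 2 * w q) = 1 / z q" if "q \<in> U" for q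
    using z[OF that] by (simp add: exp_minus field_simps)
  interpret constant_astigmatism U w
  proof
    fix p assume p: "p \<in> U"
    let ?z = "exp (2 * w p)"
    have smooth_inv: "smooth_on U (\<lambda>q. 1 / z q)"
      using U smooth_z assms(2) by (auto intro!: smooth_intros)
    have smooth: "smooth_on U (\<lambda>q. exp (2 * w q))" "smooth_on U (\<lambda>q. exp (- 2 * w q))"
      using U smooth_w by (auto intro!: smooth_intros)
    note d = smooth_on_pd[OF U smooth_z] smooth_on_pd[OF U smooth_inv]
    have "pd2 (pd2 (\<lambda>q. exp (2 * w q))) p = pd2 (pd2 z) p"
      using p z d U smooth by (intro pd_cong(2)[of U] smooth_on_imp_differentiable[of U]) auto
    moreover have "pd1 (pd1 (\<lambda>q. exp (- 2 * w q))) p = pd1 (pd1 (\<lambda>q. 1 / z q)) p"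
      using p z' d U smooth by (intro pd_cong(1)[of U] smooth_on_imp_differentiable[of U]) auto
    \<comment> \<open>The factor e^(2w) clears the negative exponentials that stem from 1/z.\<close>
    ultimately have "0 = ?z * (pd2 (pd2 (\<lambda>q. exp (2 * w q))) p + pd1 (pd1 (\<lambda>q. exp (- 2 * w q))) p + 2)"
      using equation[OF p] by simp
    also have "\<dots> = 2 * (?z\<^sup>2 * (pd2 (pd2 w) p + 2 * (pd2 w p)\<^sup>2) - (pd1 (pd1 w) p - 2 * (pd1 w p)\<^sup>2) + ?z)"
      unfolding pd_pd_exp[OF U smooth_w p] by (simp add: exp_minus field_simps power2_eq_square)
    finally show "pd1 (pd1 w) p - ?z\<^sup>2 * pd2 (pd2 w) p =
        2 * (pd1 w p)\<^sup>2 + 2 * ?z\<^sup>2 * (pd2 w p)\<^sup>2 + ?z"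
      by (simp add: algebra_simps)
  qed (use U smooth_w in auto)
  show ?thesis
    by (intro conjI ballI allI impI; (elim conjE)?)
      (rule exists_angle_xi_eta exists_coordinates sine_gordon_in_coordinates; assumption)+
qed

end
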